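(* Let $C$ be a category with pullbacks. Let $M$ and $E$ be systems of $C$ with $M$ stable and left-cancelable. Assume that $\tau$ is a coverage on $C$ subordinated to $M$. 1. (Subobjects) Let $J$ be a class of diagram types. If $a\to b$ is a morphism in $M$ and $b$ is $\tau_{J,M}$-compact, then $a$ is $\tau_{J,M}$-compact. In particular, $M$-Noetherian objects and $M$-Artinian objects are each closed under $M$-subobjects. 2. (Quotients) Let $f\colon a\to b$ be a morphism in $C$ with $a$ $\tau$-compact. If $f$ is stably $M$-extremal, then $b$ is $\tau$-compact. Furthermore, if $E$ is right-cancelable, $E\cap M$ consists of isomorphisms and $f$ is stably in $E$, then $b$ is $\tau$-compact. 3. (Weak extensions) Assume that $E$ satisfies the $M$-protomodularity condition. Consider a pullback square in $C$ with $\bar f\colon a\to d$, $\bar\phi\colon a\to b$, $f\colon b\to c$, $\phi\colon d\to c$ and $f\bar\phi=\phi\bar f$, where $a$ and $c$ are $\tau$-compact. If $f$ is $(E,M)$-image compatible with $\tau$, then $b$ is $\tau$-compact.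
   Context: Morphism classes. Let $C$ have pullbacks. A class of morphisms is a system if it contains all isomorphisms and is closed under composition; it is stable if it is closed under pullback along arbitrary morphisms; it is left-cancelable if $gf\in A$ and $g\in A$ imply $f\in A$, and right-cancelable if $gf\in A$ and $f\in A$ imply $g\in A$. A morphism $f$ is $M$-extremal (an $M$-extremal epimorphism) if $f=mg$ with $m\in M$ implies that $m$ is an isomorphism. A morphism stably has a property (or is stably in a class) if every pullback of it has the property (is in the class). A class of objects $X$ is closed under $M$-subobjects if $b\in X$ and $a\to b\in M$ imply $a\in X$. Variance. A variance on a category $I$ is a pair $(\mathrm{Cov},\mathrm{Contr})$ of classes of morphisms, each closed under composition and containing all identities, such that each morphism factors uniquely as $ba$ with $a\in \mathrm{Cov}$, $b\in\mathrm{Contr}$, and also uniquely as $ab$ with $a\in\mathrm{Cov}$, $b\in\mathrm{Contr}$. For $f\colon x\to y$ write $f=f^-f^+$ with $f^+\colon x\to f_t$ in $\mathrm{Cov}$, $f^-\colon f_t\to y$ in $\mathrm{Contr}$, and $f=f_+f_-$ with $f_-\colon x\to f_s$ in $\mathrm{Contr}$, $f_+\colon f_s\to y$ in $\mathrm{Cov}$. A functor $F\colon I\to D$ of variance $(\mathrm{Cov},\mathrm{Contr})$ assigns to each object $i$ an object $F(i)$ and to each morphism $f$ a morphism $F(f)\colon F(f_s)\to F(f_t)$, preserving identities, such that for each composable $x\xrightarrow{f}y\xrightarrow{g}z$, $$F(gf)=F((g^+f^-)^+)\circ F(f)\circ F((g_-f_+)_-)=F((g^+f^-)^-)\circ F(g)\circ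 F((g_-f_+)_+).$$ A natural transformation $\eta\colon F\Rightarrow G$ of such functors is a family $\eta_i\colon F(i)\to G(i)$ with $G(f)\eta_{f_s}=\eta_{f_t}F(f)$ for every morphism $f$ of $I$. The covariant variance is (all morphisms, identities); the contravariant variance is (identities, all morphisms); functors of these variances are ordinary covariant, respectively contravariant, functors. Coverages. A diagram type is a tuple $(I,A,\mathrm{Cov},\mathrm{Contr})$ with $I$ a small category with variance $(\mathrm{Cov},\mathrm{Contr})$ and $A$ a set of objects of $I$ (the designated small objects) such that for all $x,y\in A$ there are morphisms $x\to z\leftarrow y$ in $I$ with $z\in A$. A global selection $\tau$ on $C$ assigns to each object $c$ a class $\tau_c$ of tuples $(F\colon I\to C/c,A,\mathrm{Cov},\mathrm{Contr})$, called coverings of $c$, where $(I,A,\mathrm{Cov},\mathrm{Contr})$ is a diagram type and $F$ is a functor of variance $(\mathrm{Cov},\mathrm{Contr})$ into the slice category $C/c$. For an object $i$ of $I$, $F(i)$ is regarded as a morphism $c_i\to c$ of $C$. A global selection is a coverage if for each $f\colon x\to y$ and each covering $(F,A,\mathrm{Cov},\mathrm{Contr})$ of $y$, the tuple $(f^*(F),A,\mathrm{Cov},\mathrm{Contr})$ is a covering of $x$, where $f^*(F)\colon I\to C/x$ is the functor of variance $(\mathrm{Cov},\mathrm{Contr})$ induced by pulling back along $f$. An object $c$ is $\tau$-compact if for every covering $(F,A,\mathrm{Cov},\mathrm{Contr})$ of $c$ there is $i_0\in A$ such that $F(k)$ is an isomorphism for any composable pair $i_0\to i\xrightarrow{k}j$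 in $I$. A functor $F\colon I\to C/c$ is subordinated to $M$ if $F(i)\in M$ for each object $i$ of $I$; $\tau$ is subordinated to $M$ if all its coverings are. For a class $J$ of diagram types and a stable system $M$, $\tau_{J,M}$ is the coverage whose coverings of $c$ are all tuples $(F\colon I\to C/c,A,\mathrm{Cov},\mathrm{Contr})$ with $(I,A,\mathrm{Cov},\mathrm{Contr})\in J$ and $F$ a functor of variance $(\mathrm{Cov},\mathrm{Contr})$ subordinated to $M$. $M$-Noetherian (resp. $M$-Artinian) objects are the $\tau_{J,M}$-compact objects where $J$ consists of the single diagram type given by the poset $\mathbb N$ with all objects designated small and with the covariant (resp. contravariant) variance. Image compatibility. A morphism $f\colon c\to d$ is $(E,M)$-image compatible with $\tau$ if for every covering $(F\colon I\to C/c,A,\mathrm{Cov},\mathrm{Contr})\in\tau_c$ there are a covering $(G\colon I\to C/d,A,\mathrm{Cov},\mathrm{Contr})\in\tau_d$ subordinated to $M$ and a natural transformation $\eta\colon f_*F\Rightarrow G$ whose components lie in $E$ (as morphisms of $C$), where $f_*\colon C/c\to C/d$ is post-composition with $f$. Protomodularity. $E$ satisfies the $M$-protomodularity condition if the following holds: given morphisms $m'\colon a'\to b'$, $e'\colon b'\to c'$, $m\colon a\to b$, $e\colon b\to c$, $\alpha\colon a'\to a$, $\beta\colon b'\to b$, $\gamma\colon c'\to c$ with $\beta m'=m\alpha$ a pullback square, $e\beta=\gamma e'$, $m$ a pullback along $e$ of some morphism $\theta\colon w\to c$, $e,e'\in E$, $\beta\in M$, and $\alpha,\gamma$ isomorphisms,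 then $\beta$ is an isomorphism. *)

theory Defs
  imports Main "HOL-Library.FuncSet"
begin

section \<open>Categories\<close>

record ('o, 'm) cat =
  Obj :: "'o set"
  Arr :: "'m set"
  Src :: "'m \<Rightarrow> 'o"
  Tgt :: "'m \<Rightarrow> 'o"
  Ident :: "'o \<Rightarrow> 'm"
  Comp :: "'m \<Rightarrow> 'm \<Rightarrow> 'm" (infixl "\<cdot>\<index>" 70)

definition Hom :: "('o, 'm) cat \<Rightarrow> 'o \<Rightarrow> 'o \<Rightarrow> 'm set" where
  "Hom C x y = {f \<in> Arr C. Src C f = x \<and> Tgt C f = y}"

locale category =
  fixes C :: "('o, 'm) cat" (structure)
  assumes Src_in_Obj: "f \<in> Arr C \<Longrightarrow> Src C f \<in> Obj C"
    and Tgt_in_Obj: "f \<in> Arr C \<Longrightarrow> Tgt C f \<in> Obj C"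
    and Ident_in_Hom: "x \<in> Obj C \<Longrightarrow> Ident C x \<in> Hom C x x"
    and Comp_in_Hom: "f \<in> Hom C x y \<Longrightarrow> g \<in> Hom C y z \<Longrightarrow> g \<cdot> f \<in> Hom C x z"
    and Comp_Ident_left: "f \<in> Hom C x y \<Longrightarrow> Ident C y \<cdot> f = f"
    and Comp_Ident_right: "f \<in> Hom C x y \<Longrightarrow> f \<cdot> Ident C x = f"
    and Comp_assoc: "f \<in> Hom C w x \<Longrightarrow> g \<in> Hom C x y \<Longrightarrow> h \<in> Hom C y z
          \<Longrightarrow> (h \<cdot> g) \<cdot> f = h \<cdot> (g \<cdot> f)"

definition composable :: "('o, 'm) cat \<Rightarrow> 'm \<Rightarrow> 'm \<Rightarrow> bool" where
  "composable C g f \<longleftrightarrow> f \<in> Arr C \<and> g \<in> Arr C \<and> Tgt C f = Src C g"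

definition iso :: "('o, 'm) cat \<Rightarrow> 'm \<Rightarrow> bool" where
  "iso C f \<longleftrightarrow> f \<in> Arr C \<and>
     (\<exists>g \<in> Hom C (Tgt C f) (Src C f).
        g \<cdot>\<^bsub>C\<^esub> f = Ident C (Src C f) \<and> f \<cdot>\<^bsub>C\<^esub> g = Ident C (Tgt C f))"

text \<open>The square \<open>f p = g q\<close> is a pullback; thus \<open>p\<close> is a pullback of \<open>g\<close> along \<open>f\<close>
  and \<open>q\<close> is a pullback of \<open>f\<close> along \<open>g\<close>.\<close>

definition is_pullback :: "('o, 'm) cat \<Rightarrow> 'm \<Rightarrow> 'm \<Rightarrow> 'm \<Rightarrow> 'm \<Rightarrow> bool" where
  "is_pullback C f g p q \<longleftrightarrow>
     composable C f p \<and> composable C g q \<and> Src C p = Src C q \<and>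
     f \<cdot>\<^bsub>C\<^esub> p = g \<cdot>\<^bsub>C\<^esub> q \<and> Tgt C f = Tgt C g \<and>
     (\<forall>r s. composable C f r \<and> composable C g s \<and> Src C r = Src C s \<and>
            f \<cdot>\<^bsub>C\<^esub> r = g \<cdot>\<^bsub>C\<^esub> s \<longrightarrow>
        (\<exists>!u. u \<in> Hom C (Src C r) (Src C p) \<and> p \<cdot>\<^bsub>C\<^esub> u = r \<and> q \<cdot>\<^bsub>C\<^esub> u = s))"

text \<open>Forming \<open>f\<^sup>*(F)\<close> presupposes a choice \<open>pb f g = (p, q)\<close> of a pullback square
  \<open>f p = g q\<close> for every cospan. A category has pullbacks iff such a choice exists.\<close>

definition pullback_choice :: "('o, 'm) cat \<Rightarrow> ('m \<Rightarrow> 'm \<Rightarrow> 'm \<times> 'm) \<Rightarrow> bool" where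
  "pullback_choice C pb \<longleftrightarrow>
     (\<forall>f \<in> Arr C. \<forall>g \<in> Arr C. Tgt C f = Tgt C g \<longrightarrow>
        is_pullback C f g (fst (pb f g)) (snd (pb f g)))"

text \<open>An arrow \<open>p \<rightarrow> q\<close> of the slice over \<open>c\<close> is a triple \<open>(p, h, q)\<close> with \<open>q h = p\<close>.\<close>

definition slice :: "('o, 'm) cat \<Rightarrow> 'o \<Rightarrow> ('m, 'm \<times> 'm \<times> 'm) cat" where
  "slice C c = \<lparr>
     Obj = {p \<in> Arr C. Tgt C p = c},
     Arr = {(p, h, q). p \<in> Arr C \<and> Tgt C p = c \<and> q \<in> Arr C \<and> Tgt C q = c \<and>
                       h \<in> Hom C (Src C p) (Src C q) \<and> q \<cdot>\<^bsub>C\<^esub> h = p},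
     Src = (\<lambda>(p, h, q). p),
     Tgt = (\<lambda>(p, h, q). q),
     Ident = (\<lambda>p. (p, Ident C (Src C p), p)),
     Comp = (\<lambda>(q, k, r) (p, h, q'). (p, k \<cdot>\<^bsub>C\<^esub> h, r))\<rparr>"

definition slice_mor :: "'m \<times> 'm \<times> 'm \<Rightarrow> 'm" where
  "slice_mor = (\<lambda>(p, h, q). h)"


section \<open>Classes of morphisms\<close>

definition system :: "('o, 'm) cat \<Rightarrow> 'm set \<Rightarrow> bool" where
  "system C A \<longleftrightarrow> A \<subseteq> Arr C \<and> (\<forall>f. iso C f \<longrightarrow> f \<in> A) \<and>
     (\<forall>f \<in> A. \<forall>g \<in> A. composable C g f \<longrightarrow> g \<cdot>\<^bsub>C\<^esub> f \<in> A)"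

definition stable :: "('o, 'm) cat \<Rightarrow> 'm set \<Rightarrow> bool" where
  "stable C A \<longleftrightarrow> (\<forall>f \<in> A. \<forall>g p q. is_pullback C f g p q \<longrightarrow> q \<in> A)"

definition left_cancelable :: "('o, 'm) cat \<Rightarrow> 'm set \<Rightarrow> bool" where
  "left_cancelable C A \<longleftrightarrow>
     (\<forall>f g. composable C g f \<and> g \<cdot>\<^bsub>C\<^esub> f \<in> A \<and> g \<in> A \<longrightarrow> f \<in> A)"

definition right_cancelable :: "('o, 'm) cat \<Rightarrow> 'm set \<Rightarrow> bool" where
  "right_cancelable C A \<longleftrightarrow>
     (\<forall>f g. composable C g f \<and> g \<cdot>\<^bsub>C\<^esub> f \<in> A \<and> f \<in> A \<longrightarrow> g \<in> A)"

definition extremal :: "('o, 'm) cat \<Rightarrow> 'm set \<Rightarrow> 'm \<Rightarrow> bool" where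
  "extremal C M f \<longleftrightarrow> f \<in> Arr C \<and>
     (\<forall>m \<in> M. \<forall>g. composable C m g \<and> f = m \<cdot>\<^bsub>C\<^esub> g \<longrightarrow> iso C m)"

definition stably :: "('o, 'm) cat \<Rightarrow> ('m \<Rightarrow> bool) \<Rightarrow> 'm \<Rightarrow> bool" where
  "stably C P f \<longleftrightarrow> f \<in> Arr C \<and> (\<forall>g p q. is_pullback C f g p q \<longrightarrow> P q)"

definition closed_under_subobjects :: "('o, 'm) cat \<Rightarrow> 'm set \<Rightarrow> 'o set \<Rightarrow> bool" where
  "closed_under_subobjects C M X \<longleftrightarrow> (\<forall>m \<in> M. Tgt C m \<in> X \<longrightarrow> Src C m \<in> X)"

definition protomodularity :: "('o, 'm) cat \<Rightarrow> 'm set \<Rightarrow> 'm set \<Rightarrow> bool" where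
  "protomodularity C M E \<longleftrightarrow>
     (\<forall>a' b' c' a b c m' e' m e \<alpha> \<beta> \<gamma>.
        m' \<in> Hom C a' b' \<and> e' \<in> Hom C b' c' \<and> m \<in> Hom C a b \<and> e \<in> Hom C b c \<and>
        \<alpha> \<in> Hom C a' a \<and> \<beta> \<in> Hom C b' b \<and> \<gamma> \<in> Hom C c' c \<and>
        is_pullback C \<beta> m m' \<alpha> \<and> e \<cdot>\<^bsub>C\<^esub> \<beta> = \<gamma> \<cdot>\<^bsub>C\<^esub> e' \<and>
        (\<exists>w \<theta> q. \<theta> \<in> Hom C w c \<and> is_pullback C e \<theta> m q) \<and>
        e \<in> E \<and> e' \<in> E \<and> \<beta> \<in> M \<and> iso C \<alpha> \<and> iso C \<gamma>
        \<longrightarrow> iso C \<beta>)"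


section \<open>Variance\<close>

definition variance :: "('i, 'k) cat \<Rightarrow> 'k set \<Rightarrow> 'k set \<Rightarrow> bool" where
  "variance I Cv Ct \<longleftrightarrow>
     Cv \<subseteq> Arr I \<and> Ct \<subseteq> Arr I \<and>
     (\<forall>x \<in> Obj I. Ident I x \<in> Cv \<and> Ident I x \<in> Ct) \<and>
     (\<forall>f \<in> Cv. \<forall>g \<in> Cv. composable I g f \<longrightarrow> g \<cdot>\<^bsub>I\<^esub> f \<in> Cv) \<and>
     (\<forall>f \<in> Ct. \<forall>g \<in> Ct. composable I g f \<longrightarrow> g \<cdot>\<^bsub>I\<^esub> f \<in> Ct) \<and>
     (\<forall>f \<in> Arr I.
        (\<exists>!ab. fst ab \<in> Cv \<and> snd ab \<in> Ct \<and> composable I (snd ab) (fst ab) \<and>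
               f = snd ab \<cdot>\<^bsub>I\<^esub> fst ab) \<and>
        (\<exists>!ab. fst ab \<in> Cv \<and> snd ab \<in> Ct \<and> composable I (fst ab) (snd ab) \<and>
               f = fst ab \<cdot>\<^bsub>I\<^esub> snd ab))"

record ('i, 'k) diagram_type =
  Shape :: "('i, 'k) cat"
  Small :: "'i set"
  Cov :: "'k set"
  Contr :: "'k set"

definition is_diagram_type :: "('i, 'k) diagram_type \<Rightarrow> bool" where
  "is_diagram_type T \<longleftrightarrow>
     category (Shape T) \<and> variance (Shape T) (Cov T) (Contr T) \<and>
     Small T \<subseteq> Obj (Shape T) \<and>
     (\<forall>x \<in> Small T. \<forall>y \<in> Small T. \<exists>z \<in> Small T.
        Hom (Shape T) x z \<noteq> {} \<and> Hom (Shape T) y z \<noteq> {})"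

text \<open>\<open>f = f\<^sup>- f\<^sup>+\<close> through \<open>f\<^sub>t\<close> gives \<open>sup_cov\<close>, \<open>sup_contr\<close>, \<open>var_tgt\<close>, and
  \<open>f = f\<^sub>+ f\<^sub>-\<close> through \<open>f\<^sub>s\<close> gives \<open>sub_cov\<close>, \<open>sub_contr\<close>, \<open>var_src\<close>.\<close>

definition sup_fact :: "('i, 'k) diagram_type \<Rightarrow> 'k \<Rightarrow> 'k \<times> 'k" where
  "sup_fact T f = (THE ab. fst ab \<in> Cov T \<and> snd ab \<in> Contr T \<and>
     composable (Shape T) (snd ab) (fst ab) \<and> f = snd ab \<cdot>\<^bsub>Shape T\<^esub> fst ab)"

definition sub_fact :: "('i, 'k) diagram_type \<Rightarrow> 'k \<Rightarrow> 'k \<times> 'k" where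
  "sub_fact T f = (THE ab. fst ab \<in> Cov T \<and> snd ab \<in> Contr T \<and>
     composable (Shape T) (fst ab) (snd ab) \<and> f = fst ab \<cdot>\<^bsub>Shape T\<^esub> snd ab)"

definition sup_cov :: "('i, 'k) diagram_type \<Rightarrow> 'k \<Rightarrow> 'k" where
  "sup_cov T f = fst (sup_fact T f)"

definition sup_contr :: "('i, 'k) diagram_type \<Rightarrow> 'k \<Rightarrow> 'k" where
  "sup_contr T f = snd (sup_fact T f)"

definition sub_cov :: "('i, 'k) diagram_type \<Rightarrow> 'k \<Rightarrow> 'k" where
  "sub_cov T f = fst (sub_fact T f)"

definition sub_contr :: "('i, 'k) diagram_type \<Rightarrow> 'k \<Rightarrow> 'k" where
  "sub_contr T f = snd (sub_fact T f)"

definition var_tgt :: "('i, 'k) diagram_type \<Rightarrow> 'k \<Rightarrow> 'i" where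
  "var_tgt T f = Tgt (Shape T) (sup_cov T f)"

definition var_src :: "('i, 'k) diagram_type \<Rightarrow> 'k \<Rightarrow> 'i" where
  "var_src T f = Tgt (Shape T) (sub_contr T f)"

record ('i, 'k, 'o, 'm) functor_data =
  FObj :: "'i \<Rightarrow> 'o"
  FArr :: "'k \<Rightarrow> 'm"

text \<open>Functors are extensional outside the index category, so that two functors with the same
  values are equal; this matters when asking whether a functor belongs to a class of coverings.\<close>

definition variance_functor ::
  "('i, 'k) diagram_type \<Rightarrow> ('o, 'm) cat \<Rightarrow> ('i, 'k, 'o, 'm) functor_data \<Rightarrow> bool" where
  "variance_functor T D F \<longleftrightarrow>
     FObj F \<in> Obj (Shape T) \<rightarrow>\<^sub>E Obj D \<and>
     FArr F \<in> extensional (Arr (Shape T)) \<and>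
     (\<forall>f \<in> Arr (Shape T). FArr F f \<in> Hom D (FObj F (var_src T f)) (FObj F (var_tgt T f))) \<and>
     (\<forall>x \<in> Obj (Shape T). FArr F (Ident (Shape T) x) = Ident D (FObj F x)) \<and>
     (\<forall>f g. composable (Shape T) g f \<longrightarrow>
        (let u = sup_cov T g \<cdot>\<^bsub>Shape T\<^esub> sup_contr T f;
             v = sub_contr T g \<cdot>\<^bsub>Shape T\<^esub> sub_cov T f
         in FArr F (g \<cdot>\<^bsub>Shape T\<^esub> f) =
              (FArr F (sup_cov T u) \<cdot>\<^bsub>D\<^esub> FArr F f) \<cdot>\<^bsub>D\<^esub> FArr F (sub_contr T v) \<and>
            FArr F (g \<cdot>\<^bsub>Shape T\<^esub> f) =
              (FArr F (sup_contr T u) \<cdot>\<^bsub>D\<^esub> FArr F g) \<cdot>\<^bsub>D\<^esub> FArr F (sub_cov T v)))"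

definition natural_transformation ::
  "('i, 'k) diagram_type \<Rightarrow> ('o, 'm) cat \<Rightarrow> ('i, 'k, 'o, 'm) functor_data
     \<Rightarrow> ('i, 'k, 'o, 'm) functor_data \<Rightarrow> ('i \<Rightarrow> 'm) \<Rightarrow> bool" where
  "natural_transformation T D F G \<eta> \<longleftrightarrow>
     (\<forall>i \<in> Obj (Shape T). \<eta> i \<in> Hom D (FObj F i) (FObj G i)) \<and>
     (\<forall>f \<in> Arr (Shape T).
        FArr G f \<cdot>\<^bsub>D\<^esub> \<eta> (var_src T f) = \<eta> (var_tgt T f) \<cdot>\<^bsub>D\<^esub> FArr F f)"


section \<open>Coverages\<close>

text \<open>A functor into the slice over \<open>c\<close>; its value \<open>FObj F i\<close> is an arrow with target \<open>c\<close>.\<close>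

type_synonym ('i, 'k, 'm) slice_functor = "('i, 'k, 'm, 'm \<times> 'm \<times> 'm) functor_data"

type_synonym ('i, 'k, 'o, 'm) selection =
  "'o \<Rightarrow> (('i, 'k) diagram_type \<times> ('i, 'k, 'm) slice_functor) set"

definition global_selection :: "('o, 'm) cat \<Rightarrow> ('i, 'k, 'o, 'm) selection \<Rightarrow> bool" where
  "global_selection C \<tau> \<longleftrightarrow>
     (\<forall>c \<in> Obj C. \<forall>(T, F) \<in> \<tau> c. is_diagram_type T \<and> variance_functor T (slice C c) F)"

text \<open>The functors \<open>f\<^sup>* : C/y \<rightarrow> C/x\<close> and \<open>f\<^sub>* : C/x \<rightarrow> C/y\<close> for \<open>f : x \<rightarrow> y\<close>.\<close>

definition pull_obj :: "('m \<Rightarrow> 'm \<Rightarrow> 'm \<times> 'm) \<Rightarrow> 'm \<Rightarrow> 'm \<Rightarrow> 'm" where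
  "pull_obj pb f p = fst (pb f p)"

definition pull_arr ::
  "('o, 'm) cat \<Rightarrow> ('m \<Rightarrow> 'm \<Rightarrow> 'm \<times> 'm) \<Rightarrow> 'm \<Rightarrow> 'm \<times> 'm \<times> 'm \<Rightarrow> 'm \<times> 'm \<times> 'm" where
  "pull_arr C pb f = (\<lambda>(p, h, q).
     (pull_obj pb f p,
      THE u. u \<in> Hom C (Src C (pull_obj pb f p)) (Src C (pull_obj pb f q)) \<and>
             pull_obj pb f q \<cdot>\<^bsub>C\<^esub> u = pull_obj pb f p \<and>
             snd (pb f q) \<cdot>\<^bsub>C\<^esub> u = h \<cdot>\<^bsub>C\<^esub> snd (pb f p),
      pull_obj pb f q))"

definition push_obj :: "('o, 'm) cat \<Rightarrow> 'm \<Rightarrow> 'm \<Rightarrow> 'm" where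
  "push_obj C f p = f \<cdot>\<^bsub>C\<^esub> p"

definition push_arr :: "('o, 'm) cat \<Rightarrow> 'm \<Rightarrow> 'm \<times> 'm \<times> 'm \<Rightarrow> 'm \<times> 'm \<times> 'm" where
  "push_arr C f = (\<lambda>(p, h, q). (push_obj C f p, h, push_obj C f q))"

definition pull_functor ::
  "('o, 'm) cat \<Rightarrow> ('m \<Rightarrow> 'm \<Rightarrow> 'm \<times> 'm) \<Rightarrow> ('i, 'k) diagram_type \<Rightarrow> 'm
     \<Rightarrow> ('i, 'k, 'm) slice_functor \<Rightarrow> ('i, 'k, 'm) slice_functor" where
  "pull_functor C pb T f F = \<lparr>
     FObj = (\<lambda>i \<in> Obj (Shape T). pull_obj pb f (FObj F i)),
     FArr = (\<lambda>k \<in> Arr (Shape T). pull_arr C pb f (FArr F k))\<rparr>"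

definition push_functor ::
  "('o, 'm) cat \<Rightarrow> ('i, 'k) diagram_type \<Rightarrow> 'm
     \<Rightarrow> ('i, 'k, 'm) slice_functor \<Rightarrow> ('i, 'k, 'm) slice_functor" where
  "push_functor C T f F = \<lparr>
     FObj = (\<lambda>i \<in> Obj (Shape T). push_obj C f (FObj F i)),
     FArr = (\<lambda>k \<in> Arr (Shape T). push_arr C f (FArr F k))\<rparr>"

definition coverage ::
  "('o, 'm) cat \<Rightarrow> ('m \<Rightarrow> 'm \<Rightarrow> 'm \<times> 'm) \<Rightarrow> ('i, 'k, 'o, 'm) selection \<Rightarrow> bool" where
  "coverage C pb \<tau> \<longleftrightarrow> global_selection C \<tau> \<and>
     (\<forall>f \<in> Arr C. \<forall>(T, F) \<in> \<tau> (Tgt C f). (T, pull_functor C pb T f F) \<in> \<tau> (Src C f))"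

definition functor_subordinated ::
  "'m set \<Rightarrow> ('i, 'k) diagram_type \<Rightarrow> ('i, 'k, 'm) slice_functor \<Rightarrow> bool" where
  "functor_subordinated M T F \<longleftrightarrow> (\<forall>i \<in> Obj (Shape T). FObj F i \<in> M)"

definition subordinated ::
  "('o, 'm) cat \<Rightarrow> 'm set \<Rightarrow> ('i, 'k, 'o, 'm) selection \<Rightarrow> bool" where
  "subordinated C M \<tau> \<longleftrightarrow>
     (\<forall>c \<in> Obj C. \<forall>(T, F) \<in> \<tau> c. functor_subordinated M T F)"

definition compact_obj :: "('o, 'm) cat \<Rightarrow> ('i, 'k, 'o, 'm) selection \<Rightarrow> 'o \<Rightarrow> bool" where
  "compact_obj C \<tau> c \<longleftrightarrow> c \<in> Obj C \<and>
     (\<forall>(T, F) \<in> \<tau> c. \<exists>i\<^sub>0 \<in> Small T. \<forall>l k.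
        composable (Shape T) k l \<and> Src (Shape T) l = i\<^sub>0 \<longrightarrow> iso (slice C c) (FArr F k))"

definition tau ::
  "('o, 'm) cat \<Rightarrow> ('i, 'k) diagram_type set \<Rightarrow> 'm set \<Rightarrow> ('i, 'k, 'o, 'm) selection" where
  "tau C J M c =
     {(T, F). T \<in> J \<and> variance_functor T (slice C c) F \<and> functor_subordinated M T F}"

definition image_compatible ::
  "('o, 'm) cat \<Rightarrow> 'm set \<Rightarrow> 'm set \<Rightarrow> ('i, 'k, 'o, 'm) selection \<Rightarrow> 'm \<Rightarrow> bool" where
  "image_compatible C E M \<tau> f \<longleftrightarrow> f \<in> Arr C \<and>
     (\<forall>(T, F) \<in> \<tau> (Src C f). \<exists>G \<eta>. (T, G) \<in> \<tau> (Tgt C f) \<and> functor_subordinated M T G \<and>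
        natural_transformation T (slice C (Tgt C f)) (push_functor C T f F) G \<eta> \<and>
        (\<forall>i \<in> Obj (Shape T). slice_mor (\<eta> i) \<in> E))"


section \<open>Noetherian and Artinian objects\<close>

definition nat_cat :: "(nat, nat \<times> nat) cat" where
  "nat_cat = \<lparr>Obj = UNIV, Arr = {(m, n). m \<le> n}, Src = fst, Tgt = snd,
     Ident = (\<lambda>n. (n, n)), Comp = (\<lambda>g f. (fst f, snd g))\<rparr>"

definition nat_covariant :: "(nat, nat \<times> nat) diagram_type" where
  "nat_covariant = \<lparr>Shape = nat_cat, Small = UNIV,
     Cov = Arr nat_cat, Contr = range (Ident nat_cat)\<rparr>"

definition nat_contravariant :: "(nat, nat \<times> nat) diagram_type" where
  "nat_contravariant = \<lparr>Shape = nat_cat, Small = UNIV,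
     Cov = range (Ident nat_cat), Contr = Arr nat_cat\<rparr>"

definition noetherian :: "('o, 'm) cat \<Rightarrow> 'm set \<Rightarrow> 'o \<Rightarrow> bool" where
  "noetherian C M = compact_obj C (tau C {nat_covariant} M)"

definition artinian :: "('o, 'm) cat \<Rightarrow> 'm set \<Rightarrow> 'o \<Rightarrow> bool" where
  "artinian C M = compact_obj C (tau C {nat_contravariant} M)"

end

theory Submission
  imports Defs
begin

text \<open>
  For subobjects, push a covering of \<open>a\<close> forward along \<open>m\<close>. For quotients, pull a covering \<open>F\<close>
  of \<open>b\<close> back along \<open>f\<close>: if \<open>f\<^sup>*(F)(k)\<close> is invertible, then the projection from \<open>f\<^sup>*(F)(k\<^sub>t)\<close>
  to \<open>F(k\<^sub>t)\<close>, a pullback of \<open>f\<close>, factors through \<open>F(k)\<close>, which lies in \<open>M\<close> by left cancelability.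
  For weak extensions, directedness of the small objects makes the pullback to \<open>a\<close> and the image
  \<open>G\<close> over \<open>c\<close> stationary from a common small object on. Protomodularity then applies to \<open>F(k)\<close>:
  as \<open>F(k\<^sub>t)\<close> followed by \<open>f\<close> factors through \<open>G(k\<^sub>t)\<close> via \<open>\<eta>\<close>, the projection from
  \<open>\<phi>\<^sub>1\<^sup>*(F)(k\<^sub>t)\<close> to \<open>F(k\<^sub>t)\<close> is a pullback along \<open>\<eta>\<close> of the pullback of \<open>\<phi>\<close> along \<open>G(k\<^sub>t)\<close>.
\<close>

section \<open>Typed arrows, isomorphisms and the calculus of pullback squares\<close>

lemma HomD:
  assumes "f \<in> Hom C x y"
  shows "f \<in> Arr C" "Src C f = x" "Tgt C f = y"
  using assms by (auto simp: Hom_def)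

context category
begin

lemma Hom_objD:
  assumes "f \<in> Hom C x y"
  shows "x \<in> Obj C" "y \<in> Obj C"
  using assms Src_in_Obj Tgt_in_Obj by (auto simp: Hom_def)

lemma composable_compD:
  assumes "composable C g f"
  shows "g \<cdot> f \<in> Arr C" "Src C (g \<cdot> f) = Src C f" "Tgt C (g \<cdot> f) = Tgt C g"
  using assms Comp_in_Hom[of f "Src C f" "Tgt C f" g "Tgt C g"]
  by (auto simp: composable_def Hom_def)

lemma isoI:
  assumes "f \<in> Hom C x y" "g \<in> Hom C y x" "g \<cdot> f = Ident C x" "f \<cdot> g = Ident C y"
  shows "iso C f"
  using assms by (auto simp: iso_def Hom_def)

lemma isoE:
  assumes "iso C f" "f \<in> Hom C x y"
  obtains g where "g \<in> Hom C y x" "g \<cdot> f = Ident C x" "f \<cdot> g = Ident C y"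
  using assms by (auto simp: iso_def Hom_def)

text \<open>Unique factorization is split into existence and joint monicity of the projections.
  Naming the four objects lets each half be checked by composing typed arrows.\<close>

lemma is_pullbackI:
  assumes h: "f \<in> Hom C x z" "g \<in> Hom C y z" "p \<in> Hom C w x" "q \<in> Hom C w y"
    and eq: "f \<cdot> p = g \<cdot> q"
    and ex: "\<And>t r s. r \<in> Hom C t x \<Longrightarrow> s \<in> Hom C t y \<Longrightarrow> f \<cdot> r = g \<cdot> s \<Longrightarrow>
               \<exists>u \<in> Hom C t w. p \<cdot> u = r \<and> q \<cdot> u = s"
    and un: "\<And>t u v. u \<in> Hom C t w \<Longrightarrow> v \<in> Hom C t w \<Longrightarrow> p \<cdot> u = p \<cdot> v \<Longrightarrow> q \<cdot> u = q \<cdot> v \<Longrightarrow> u = v"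
  shows "is_pullback C f g p q"
proof -
  have "\<exists>!u. u \<in> Hom C (Src C r) (Src C p) \<and> p \<cdot> u = r \<and> q \<cdot> u = s"
    if "composable C f r \<and> composable C g s \<and> Src C r = Src C s \<and> f \<cdot> r = g \<cdot> s" for r s
  proof -
    from that h have rs: "r \<in> Hom C (Src C r) x" "s \<in> Hom C (Src C r) y" "f \<cdot> r = g \<cdot> s"
      by (auto simp: composable_def Hom_def)
    from ex[OF this] obtain u where u: "u \<in> Hom C (Src C r) w" "p \<cdot> u = r" "q \<cdot> u = s" by blast
    have "Src C p = w" using h by (simp add: Hom_def)
    with u un show ?thesis by (intro ex1I[of _ u]) auto
  qed
  moreover have "composable C f p \<and> composable C g q \<and> Src C p = Src C q \<and> Tgt C f = Tgt C g"
    using h by (simp add: composable_def Hom_def)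
  ultimately show ?thesis using eq unfolding is_pullback_def by blast
qed

lemma is_pullback_HomD:
  assumes "is_pullback C f g p q"
  shows "f \<in> Hom C (Src C f) (Tgt C f)" "g \<in> Hom C (Src C g) (Tgt C f)"
    "p \<in> Hom C (Src C p) (Src C f)" "q \<in> Hom C (Src C p) (Src C g)" "f \<cdot> p = g \<cdot> q"
  using assms unfolding is_pullback_def composable_def Hom_def by simp_all

lemma pullback_lift:
  assumes pb: "is_pullback C f g p q" and h: "f \<in> Hom C x z" "g \<in> Hom C y z" "p \<in> Hom C w x"
    and rs: "r \<in> Hom C t x" "s \<in> Hom C t y" and eq: "f \<cdot> r = g \<cdot> s"
  obtains u where "u \<in> Hom C t w" "p \<cdot> u = r" "q \<cdot> u = s"
proof -
  have "composable C f r \<and> composable C g s \<and> Src C r = Src C s \<and> f \<cdot> r = g \<cdot> s"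
    using h rs eq by (simp add: composable_def Hom_def)
  with pb have "\<exists>u. u \<in> Hom C (Src C r) (Src C p) \<and> p \<cdot> u = r \<and> q \<cdot> u = s"
    unfolding is_pullback_def by blast
  moreover have "Src C r = t" "Src C p = w" using h rs by (auto simp: Hom_def)
  ultimately show ?thesis using that by blast
qed

text \<open>Joint monicity of the projections: \<open>u\<close> and \<open>v\<close> are both
  factorizations of the single cone formed by \<open>p u\<close> and \<open>q u\<close>.\<close>

lemma pullback_eqI:
  assumes pb: "is_pullback C f g p q" and p: "p \<in> Hom C w x"
    and uv: "u \<in> Hom C t w" "v \<in> Hom C t w" and eq: "p \<cdot> u = p \<cdot> v" "q \<cdot> u = q \<cdot> v"
  shows "u = v"
proof -
  have pt: "Src C p = w" "Src C f = x"
    using p is_pullback_HomD(3)[OF pb] by (auto simp: Hom_def)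
  note h = is_pullback_HomD[OF pb, unfolded pt]
  have r: "p \<cdot> u \<in> Hom C t x" "q \<cdot> u \<in> Hom C t (Src C g)"
    using Comp_in_Hom[OF uv(1) h(3)] Comp_in_Hom[OF uv(1) h(4)] by auto
  have "f \<cdot> (p \<cdot> u) = g \<cdot> (q \<cdot> u)"
    using Comp_assoc[OF uv(1) h(3) h(1)] Comp_assoc[OF uv(1) h(4) h(2)] h(5) by simp
  with r h(1,2) pt have "composable C f (p \<cdot> u) \<and> composable C g (q \<cdot> u) \<and> Src C (p \<cdot> u) = Src C (q \<cdot> u)
      \<and> f \<cdot> (p \<cdot> u) = g \<cdot> (q \<cdot> u)"
    by (simp add: composable_def Hom_def)
  with pb have "\<exists>!u'. u' \<in> Hom C (Src C (p \<cdot> u)) (Src C p) \<and> p \<cdot> u' = p \<cdot> u \<and> q \<cdot> u' = q \<cdot> u"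
    unfolding is_pullback_def by blast
  moreover have "Src C (p \<cdot> u) = t" using r by (simp add: Hom_def)
  ultimately show ?thesis using uv eq pt(1) by metis
qed

lemma is_pullback_sym:
  assumes pb: "is_pullback C f g p q"
  shows "is_pullback C g f q p"
proof -
  obtain x y z w where h: "f \<in> Hom C x z" "g \<in> Hom C y z" "p \<in> Hom C w x" "q \<in> Hom C w y"
    and sq: "f \<cdot> p = g \<cdot> q"
    using is_pullback_HomD[OF pb] by blast
  show ?thesis
  proof (rule is_pullbackI[OF h(2,1,4,3) sq[symmetric]])
    fix t r s assume "r \<in> Hom C t y" "s \<in> Hom C t x" "g \<cdot> r = f \<cdot> s"
    then show "\<exists>u\<in>Hom C t w. q \<cdot> u = r \<and> p \<cdot> u = s"
      using pullback_lift[OF pb h(1-3)] by metis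
  qed (use pullback_eqI[OF pb h(3)] in blast)
qed

text \<open>Two squares are glued along the shared edge \<open>p\<close>. A cone over the rectangle
  lifts first through \<open>A\<close>, using \<open>k r\<close> as a leg, and the result then lifts
  through \<open>B\<close>.\<close>

lemma pullback_paste:
  assumes A: "is_pullback C f g p q" and B: "is_pullback C p k l n"
  shows "is_pullback C (f \<cdot> k) g n (q \<cdot> l)"
proof -
  obtain x y z w where h: "f \<in> Hom C x z" "g \<in> Hom C y z" "p \<in> Hom C w x" "q \<in> Hom C w y"
    and sq: "f \<cdot> p = g \<cdot> q"
    using is_pullback_HomD[OF A] by blast
  obtain v a where h': "k \<in> Hom C v x" "l \<in> Hom C a w" "n \<in> Hom C a v" and sq': "p \<cdot> l = k \<cdot> n"
    using is_pullback_HomD[OF B] h(3) HomD[OF h(3)] by metis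
  have fk: "f \<cdot> k \<in> Hom C v z" and ql: "q \<cdot> l \<in> Hom C a y"
    using Comp_in_Hom h h' by blast+
  show ?thesis
  proof (rule is_pullbackI[OF fk h(2) h'(3) ql])
    show "(f \<cdot> k) \<cdot> n = g \<cdot> (q \<cdot> l)"
      using Comp_assoc[OF h'(3,1) h(1)] Comp_assoc[OF h'(2) h(3,1)] Comp_assoc[OF h'(2) h(4,2)] sq sq'
      by simp
  next
    fix t r s assume r: "r \<in> Hom C t v" and s: "s \<in> Hom C t y" and eq: "(f \<cdot> k) \<cdot> r = g \<cdot> s"
    have kr: "k \<cdot> r \<in> Hom C t x" using Comp_in_Hom r h'(1) by blast
    have "f \<cdot> (k \<cdot> r) = g \<cdot> s" using Comp_assoc[OF r h'(1) h(1)] eq by simp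
    from pullback_lift[OF A h(1-3) kr s this]
    obtain u where u: "u \<in> Hom C t w" "p \<cdot> u = k \<cdot> r" "q \<cdot> u = s" .
    from pullback_lift[OF B h(3) h'(1,2) u(1) r u(2)]
    obtain u' where u': "u' \<in> Hom C t a" "l \<cdot> u' = u" "n \<cdot> u' = r" .
    have "(q \<cdot> l) \<cdot> u' = s" using Comp_assoc[OF u'(1) h'(2) h(4)] u' u by simp
    with u' show "\<exists>u\<in>Hom C t a. n \<cdot> u = r \<and> (q \<cdot> l) \<cdot> u = s" by blast
  next
    fix t u u' assume u: "u \<in> Hom C t a" "u' \<in> Hom C t a"
      and e: "n \<cdot> u = n \<cdot> u'" "(q \<cdot> l) \<cdot> u = (q \<cdot> l) \<cdot> u'"
    \<comment> \<open>Joint monicity for \<open>A\<close> reduces this to \<open>p l = k n\<close>,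
      controlled by the first equation of \<open>e\<close>, and to \<open>q l\<close>, controlled by
      the second.\<close>
    have "l \<cdot> u = l \<cdot> u'"
    proof (rule pullback_eqI[OF A h(3)])
      show "l \<cdot> u \<in> Hom C t w" "l \<cdot> u' \<in> Hom C t w" using Comp_in_Hom u h' by blast+
      show "q \<cdot> (l \<cdot> u) = q \<cdot> (l \<cdot> u')" using Comp_assoc[OF u(1) h'(2) h(4)] Comp_assoc[OF u(2) h'(2) h(4)] e by simp
      show "p \<cdot> (l \<cdot> u) = p \<cdot> (l \<cdot> u')" using Comp_assoc[OF u(1) h'(2) h(3)] Comp_assoc[OF u(2) h'(2) h(3)]
          Comp_assoc[OF u(1) h'(3,1)] Comp_assoc[OF u(2) h'(3,1)] e sq' by simp
    qed
    then show "u = u'" using pullback_eqI[OF B h'(2) u] e by blast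
  qed
qed

text \<open>The converse half of pasting: the rectangle over \<open>q h\<close> and the square over
  \<open>q\<close> determine the remaining square over \<open>h\<close>. A cone over the latter
  becomes one over the rectangle by composing its second leg with \<open>p2\<close>.\<close>

lemma pullback_cancel:
  assumes A: "is_pullback C f q p2 s2" and B: "is_pullback C f (q \<cdot> h) p1 s1"
    and q: "q \<in> Hom C y z" and hh: "h \<in> Hom C x y" and s1: "s1 \<in> Hom C v x"
    and s2: "s2 \<in> Hom C w y" and u: "u \<in> Hom C v w"
    and e1: "p2 \<cdot> u = p1" and e2: "s2 \<cdot> u = h \<cdot> s1"
  shows "is_pullback C h s2 s1 u"
proof -
  obtain a where a: "f \<in> Hom C a z" "p2 \<in> Hom C w a" and sq: "f \<cdot> p2 = q \<cdot> s2"
    using is_pullback_HomD[OF A] q s2 by (auto simp: Hom_def)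
  have p1: "p1 \<in> Hom C v a" using e1 Comp_in_Hom u a by blast
  have qh: "q \<cdot> h \<in> Hom C x z" using Comp_in_Hom q hh by blast
  show ?thesis
  proof (rule is_pullbackI[OF hh s2 s1 u e2[symmetric]])
    fix t r s assume r: "r \<in> Hom C t x" and s: "s \<in> Hom C t w" and eq: "h \<cdot> r = s2 \<cdot> s"
    have ps: "p2 \<cdot> s \<in> Hom C t a" using Comp_in_Hom s a by blast
    have "f \<cdot> (p2 \<cdot> s) = (f \<cdot> p2) \<cdot> s" using Comp_assoc s a by simp
    also have "\<dots> = q \<cdot> (h \<cdot> r)" using Comp_assoc[OF s s2 q] sq eq by simp
    also have "\<dots> = (q \<cdot> h) \<cdot> r" using Comp_assoc[OF r hh q] by simp
    finally obtain d where d: "d \<in> Hom C t v" "p1 \<cdot> d = p2 \<cdot> s" "s1 \<cdot> d = r"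
      using pullback_lift[OF B a(1) qh p1 ps r] by blast
    have "u \<cdot> d = s"
    proof (rule pullback_eqI[OF A a(2)])
      show "u \<cdot> d \<in> Hom C t w" using Comp_in_Hom d(1) u by blast
      show "s \<in> Hom C t w" by (fact s)
      show "p2 \<cdot> (u \<cdot> d) = p2 \<cdot> s" using Comp_assoc[OF d(1) u a(2)] e1 d by simp
      show "s2 \<cdot> (u \<cdot> d) = s2 \<cdot> s"
        using Comp_assoc[OF d(1) u s2] Comp_assoc[OF d(1) s1 hh] e2 d eq by simp
    qed
    with d show "\<exists>d\<in>Hom C t v. s1 \<cdot> d = r \<and> u \<cdot> d = s" by blast
  next
    fix t d d' assume d: "d \<in> Hom C t v" "d' \<in> Hom C t v"
      and e: "s1 \<cdot> d = s1 \<cdot> d'" "u \<cdot> d = u \<cdot> d'"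
    have "p1 \<cdot> d = p1 \<cdot> d'"
      using Comp_assoc[OF d(1) u a(2)] Comp_assoc[OF d(2) u a(2)] e1 e by simp
    with e pullback_eqI[OF B p1 d] show "d = d'" by blast
  qed
qed

section \<open>Invertibility in slices, and the effect of \<open>f_*\<close> and \<open>f^*\<close>
  on slice arrows\<close>

text \<open>An inverse \<open>g\<close> of \<open>h\<close> is automatically an arrow over
  \<open>c\<close>, because \<open>p g = q h g = q\<close>.\<close>

lemma iso_slice_iff:
  assumes "(p, h, q) \<in> Arr (slice C c)"
  shows "iso (slice C c) (p, h, q) \<longleftrightarrow> iso C h"
proof -
  have h: "h \<in> Hom C (Src C p) (Src C q)" and p: "p \<in> Arr C" "Tgt C p = c"
    and q: "q \<in> Hom C (Src C q) c" and e: "q \<cdot> h = p"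
    using assms by (auto simp: slice_def Hom_def)
  show ?thesis
  proof
    assume "iso (slice C c) (p, h, q)"
    then show "iso C h"
      using isoI[OF h] by (auto simp: iso_def Hom_def slice_def)
  next
    assume "iso C h"
    then obtain g where g: "g \<in> Hom C (Src C q) (Src C p)" "g \<cdot> h = Ident C (Src C p)"
      "h \<cdot> g = Ident C (Src C q)" using isoE h by blast
    have "p \<cdot> g = q" using Comp_assoc[OF g(1) h q] g(3) Comp_Ident_right[OF q] e by simp
    then have "(q, g, p) \<in> Hom (slice C c) q p"
      using g p q by (auto simp: slice_def Hom_def)
    with assms g show "iso (slice C c) (p, h, q)"
      by (auto simp: iso_def slice_def Hom_def intro!: bexI[of _ "(q, g, p)"])
  qed
qed

lemma push_arr_in_Hom:
  assumes "f \<in> Hom C x y" "k \<in> Hom (slice C x) p q"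
  shows "push_arr C f k \<in> Hom (slice C y) (push_obj C f p) (push_obj C f q)"
proof -
  obtain h where k: "k = (p, h, q)" and p: "p \<in> Hom C (Src C p) x" and q: "q \<in> Hom C (Src C q) x"
    and h: "h \<in> Hom C (Src C p) (Src C q)" and e: "q \<cdot> h = p"
    using assms(2) by (auto simp: slice_def Hom_def)
  have "f \<cdot> p \<in> Hom C (Src C p) y" "f \<cdot> q \<in> Hom C (Src C q) y" "(f \<cdot> q) \<cdot> h = f \<cdot> p"
    using Comp_in_Hom p q assms(1) Comp_assoc[OF h q assms(1)] e by auto
  with h show ?thesis by (auto simp: k push_arr_def push_obj_def slice_def Hom_def)
qed

text \<open>Pushing forward keeps the underlying arrow \<open>h\<close>, and invertibility in either
  slice depends on \<open>h\<close> alone.\<close>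

lemma iso_push_arrD:
  assumes f: "f \<in> Hom C x y" and k: "k \<in> Hom (slice C x) p q"
    and i: "iso (slice C y) (push_arr C f k)"
  shows "iso (slice C x) k"
proof -
  obtain h where k': "k = (p, h, q)" using k by (auto simp: slice_def Hom_def)
  have "(push_obj C f p, h, push_obj C f q) \<in> Arr (slice C y)"
    using push_arr_in_Hom[OF f k] by (simp add: k' push_arr_def Hom_def)
  moreover have "(p, h, q) \<in> Arr (slice C x)" using k by (simp add: k' Hom_def)
  ultimately show ?thesis using i by (simp add: iso_slice_iff k' push_arr_def)
qed

text \<open>Identifies the underlying arrow \<open>u\<close> of the pulled back slice arrow as a
  pullback of \<open>h\<close> along the projection at \<open>q\<close>. This is
  \<open>pullback_cancel\<close> for the chosen squares over \<open>q\<close> and over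
  \<open>p = q h\<close>.\<close>

lemma pull_arr_pullback:
  assumes pb: "pullback_choice C pb" and f: "f \<in> Hom C x y" and k: "(p, h, q) \<in> Arr (slice C y)"
  obtains u where "pull_arr C pb f (p, h, q) = (pull_obj pb f p, u, pull_obj pb f q)"
    "(pull_obj pb f p, u, pull_obj pb f q) \<in> Arr (slice C x)"
    "is_pullback C h (snd (pb f q)) (snd (pb f p)) u"
proof -
  have h: "h \<in> Hom C (Src C p) (Src C q)" and p: "p \<in> Hom C (Src C p) y"
    and q: "q \<in> Hom C (Src C q) y" and e: "q \<cdot> h = p"
    using k by (auto simp: slice_def Hom_def)
  have P: "is_pullback C f p (fst (pb f p)) (snd (pb f p))"
    and Q: "is_pullback C f q (fst (pb f q)) (snd (pb f q))"
    using pb f p q by (auto simp: pullback_choice_def Hom_def)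
  obtain v where v: "fst (pb f p) \<in> Hom C v x" "snd (pb f p) \<in> Hom C v (Src C p)"
    and sp: "f \<cdot> fst (pb f p) = p \<cdot> snd (pb f p)"
    using is_pullback_HomD[OF P] f by (auto simp: Hom_def)
  obtain w where w: "fst (pb f q) \<in> Hom C w x" "snd (pb f q) \<in> Hom C w (Src C q)"
    using is_pullback_HomD[OF Q] f by (auto simp: Hom_def)
  have hs: "h \<cdot> snd (pb f p) \<in> Hom C v (Src C q)" using Comp_in_Hom v h by blast
  have "f \<cdot> fst (pb f p) = q \<cdot> (h \<cdot> snd (pb f p))" using Comp_assoc[OF v(2) h q] e sp by simp
  from pullback_lift[OF Q f q w(1) v(1) hs this]
  obtain u where u: "u \<in> Hom C v w" "fst (pb f q) \<cdot> u = fst (pb f p)"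
    "snd (pb f q) \<cdot> u = h \<cdot> snd (pb f p)" .
  have sv: "Src C (fst (pb f p)) = v" "Src C (fst (pb f q)) = w" using v w by (auto simp: Hom_def)
  \<comment> \<open>The description in \<open>pull_arr\<close> denotes the lift just found;
    uniqueness is joint monicity for the chosen square \<open>Q\<close>.\<close>
  have "(THE u. u \<in> Hom C (Src C (pull_obj pb f p)) (Src C (pull_obj pb f q)) \<and>
             pull_obj pb f q \<cdot> u = pull_obj pb f p \<and>
             snd (pb f q) \<cdot> u = h \<cdot> snd (pb f p)) = u"
    using u pullback_eqI[OF Q w(1)] unfolding pull_obj_def sv by (intro the_equality) auto
  then have "pull_arr C pb f (p, h, q) = (pull_obj pb f p, u, pull_obj pb f q)"
    by (simp add: pull_arr_def)
  moreover have "(pull_obj pb f p, u, pull_obj pb f q) \<in> Arr (slice C x)"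
    using u v w by (auto simp: slice_def Hom_def pull_obj_def)
  moreover have "is_pullback C h (snd (pb f q)) (snd (pb f p)) u"
    using pullback_cancel[OF Q _ q h v(2) w(2) u] P e by simp
  ultimately show ?thesis using that by blast
qed

end

section \<open>Factorizations in a variance and functors of a given variance\<close>

text \<open>Uniqueness of both factorizations makes the descriptions \<open>sup_fact\<close> and
  \<open>sub_fact\<close> denote, so their defining properties become available.\<close>

lemma variance_fact:
  assumes "variance (Shape T) (Cov T) (Contr T)" "f \<in> Arr (Shape T)"
  shows "sup_cov T f \<in> Cov T" "sup_contr T f \<in> Contr T"
    "composable (Shape T) (sup_contr T f) (sup_cov T f)"
    "f = sup_contr T f \<cdot>\<^bsub>Shape T\<^esub> sup_cov T f"
    "sub_cov T f \<in> Cov T" "sub_contr T f \<in> Contr T"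
    "composable (Shape T) (sub_cov T f) (sub_contr T f)"
    "f = sub_cov T f \<cdot>\<^bsub>Shape T\<^esub> sub_contr T f"
proof -
  note V = assms(1)[unfolded variance_def, THEN conjunct2, THEN conjunct2, THEN conjunct2,
    THEN conjunct2, THEN conjunct2, rule_format, OF assms(2)]
  note sup = theI'[OF V[THEN conjunct1], folded sup_fact_def, folded sup_cov_def sup_contr_def]
  note sub = theI'[OF V[THEN conjunct2], folded sub_fact_def, folded sub_cov_def sub_contr_def]
  show "sup_cov T f \<in> Cov T" "sup_contr T f \<in> Contr T"
    "composable (Shape T) (sup_contr T f) (sup_cov T f)"
    "f = sup_contr T f \<cdot>\<^bsub>Shape T\<^esub> sup_cov T f"
    by (intro sup[THEN conjunct1] sup[THEN conjunct2, THEN conjunct1]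
      sup[THEN conjunct2, THEN conjunct2, THEN conjunct1]
      sup[THEN conjunct2, THEN conjunct2, THEN conjunct2])+
  show "sub_cov T f \<in> Cov T" "sub_contr T f \<in> Contr T"
    "composable (Shape T) (sub_cov T f) (sub_contr T f)"
    "f = sub_cov T f \<cdot>\<^bsub>Shape T\<^esub> sub_contr T f"
    by (intro sub[THEN conjunct1] sub[THEN conjunct2, THEN conjunct1]
      sub[THEN conjunct2, THEN conjunct2, THEN conjunct1]
      sub[THEN conjunct2, THEN conjunct2, THEN conjunct2])+
qed

text \<open>The outer ends of the factors are those of \<open>f\<close>. Hence the mixed composites
  in the functoriality law, such as \<open>sup_cov\<close> of one arrow after
  \<open>sup_contr\<close> of the preceding one, are defined.\<close>

lemma diagram_type_fact:
  assumes "is_diagram_type T" "f \<in> Arr (Shape T)"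
  shows "sup_cov T f \<in> Arr (Shape T)" "sup_contr T f \<in> Arr (Shape T)"
    "sub_cov T f \<in> Arr (Shape T)" "sub_contr T f \<in> Arr (Shape T)"
    "Src (Shape T) (sup_cov T f) = Src (Shape T) f"
    "Tgt (Shape T) (sup_contr T f) = Tgt (Shape T) f"
    "Src (Shape T) (sub_contr T f) = Src (Shape T) f"
    "Tgt (Shape T) (sub_cov T f) = Tgt (Shape T) f"
    "var_src T f \<in> Obj (Shape T)" "var_tgt T f \<in> Obj (Shape T)"
proof -
  interpret I: category "Shape T" using assms by (simp add: is_diagram_type_def)
  have "variance (Shape T) (Cov T) (Contr T)" using assms by (simp add: is_diagram_type_def)
  note F = variance_fact[OF this assms(2)]
  show arr: "sup_cov T f \<in> Arr (Shape T)" "sup_contr T f \<in> Arr (Shape T)"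
    "sub_cov T f \<in> Arr (Shape T)" "sub_contr T f \<in> Arr (Shape T)"
    using F(3,7) by (simp_all add: composable_def)
  show "Src (Shape T) (sup_cov T f) = Src (Shape T) f"
    "Tgt (Shape T) (sup_contr T f) = Tgt (Shape T) f"
    using I.composable_compD(2,3)[OF F(3), folded F(4)] by simp_all
  show "Src (Shape T) (sub_contr T f) = Src (Shape T) f"
    "Tgt (Shape T) (sub_cov T f) = Tgt (Shape T) f"
    using I.composable_compD(2,3)[OF F(7), folded F(8)] by simp_all
  show "var_src T f \<in> Obj (Shape T)" "var_tgt T f \<in> Obj (Shape T)"
    using arr I.Tgt_in_Obj by (auto simp: var_src_def var_tgt_def)
qed

lemma variance_functorD:
  assumes "variance_functor T D F"
  shows "i \<in> Obj (Shape T) \<Longrightarrow> FObj F i \<in> Obj D"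
    and "k \<in> Arr (Shape T) \<Longrightarrow> FArr F k \<in> Hom D (FObj F (var_src T k)) (FObj F (var_tgt T k))"
    and "i \<in> Obj (Shape T) \<Longrightarrow> FArr F (Ident (Shape T) i) = Ident D (FObj F i)"
    and "composable (Shape T) l k \<Longrightarrow> FArr F (l \<cdot>\<^bsub>Shape T\<^esub> k) =
      (FArr F (sup_cov T (sup_cov T l \<cdot>\<^bsub>Shape T\<^esub> sup_contr T k)) \<cdot>\<^bsub>D\<^esub> FArr F k) \<cdot>\<^bsub>D\<^esub>
      FArr F (sub_contr T (sub_contr T l \<cdot>\<^bsub>Shape T\<^esub> sub_cov T k))"
    and "composable (Shape T) l k \<Longrightarrow> FArr F (l \<cdot>\<^bsub>Shape T\<^esub> k) =
      (FArr F (sup_contr T (sup_cov T l \<cdot>\<^bsub>Shape T\<^esub> sup_contr T k)) \<cdot>\<^bsub>D\<^esub> FArr F l) \<cdot>\<^bsub>D\<^esub>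
      FArr F (sub_cov T (sub_contr T l \<cdot>\<^bsub>Shape T\<^esub> sub_cov T k))"
proof -
  note F = assms[unfolded variance_functor_def Let_def]
  show "i \<in> Obj (Shape T) \<Longrightarrow> FObj F i \<in> Obj D" using F by (meson PiE_mem)
  show "k \<in> Arr (Shape T) \<Longrightarrow> FArr F k \<in> Hom D (FObj F (var_src T k)) (FObj F (var_tgt T k))"
    using F by meson
  show "i \<in> Obj (Shape T) \<Longrightarrow> FArr F (Ident (Shape T) i) = Ident D (FObj F i)" using F by meson
  assume "composable (Shape T) l k"
  note kl = F[THEN conjunct2, THEN conjunct2, THEN conjunct2, THEN conjunct2, rule_format, OF this]
  show "FArr F (l \<cdot>\<^bsub>Shape T\<^esub> k) =
      (FArr F (sup_cov T (sup_cov T l \<cdot>\<^bsub>Shape T\<^esub> sup_contr T k)) \<cdot>\<^bsub>D\<^esub> FArr F k) \<cdot>\<^bsub>D\<^esub>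
      FArr F (sub_contr T (sub_contr T l \<cdot>\<^bsub>Shape T\<^esub> sub_cov T k))"
    by (fact kl[THEN conjunct1])
  show "FArr F (l \<cdot>\<^bsub>Shape T\<^esub> k) =
      (FArr F (sup_contr T (sup_cov T l \<cdot>\<^bsub>Shape T\<^esub> sup_contr T k)) \<cdot>\<^bsub>D\<^esub> FArr F l) \<cdot>\<^bsub>D\<^esub>
      FArr F (sub_cov T (sub_contr T l \<cdot>\<^bsub>Shape T\<^esub> sub_cov T k))"
    by (fact kl[THEN conjunct2])
qed

lemma variance_functor_arrE:
  assumes "is_diagram_type T" "variance_functor T (slice C c) F" "k \<in> Arr (Shape T)"
  obtains p h q where "FArr F k = (p, h, q)" "p = FObj F (var_src T k)"
    "q = FObj F (var_tgt T k)" "(p, h, q) \<in> Hom (slice C c) p q"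
proof -
  have "FArr F k \<in> Hom (slice C c) (FObj F (var_src T k)) (FObj F (var_tgt T k))"
    using variance_functorD(2)[OF assms(2,3)] .
  then show ?thesis using that by (auto simp: slice_def Hom_def)
qed

text \<open>Since \<open>push_arr\<close> respects slice composition, applying it to both
  functoriality equations of \<open>F\<close> gives those of the pushed functor.\<close>

lemma (in category) variance_functor_push:
  assumes T: "is_diagram_type T" and F: "variance_functor T (slice C x) F" and f: "f \<in> Hom C x y"
  shows "variance_functor T (slice C y) (push_functor C T f F)"
proof -
  interpret I: category "Shape T" using T by (simp add: is_diagram_type_def)
  let ?P = "push_functor C T f F"
  have obj: "FObj F i \<in> Hom C (Src C (FObj F i)) x" if "i \<in> Obj (Shape T)" for i
    using variance_functorD(1)[OF F that] by (simp add: slice_def Hom_def)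
  have P: "FArr ?P j = push_arr C f (FArr F j)" if "j \<in> Arr (Shape T)" for j
    using that by (simp add: push_functor_def)
  \<comment> \<open>Holds for all triples without typing: the middle components compose in the same
    way in both slices, and the outer ones are mapped separately.\<close>
  have push_comp: "push_arr C f (k \<cdot>\<^bsub>slice C x\<^esub> l) = push_arr C f k \<cdot>\<^bsub>slice C y\<^esub> push_arr C f l" for k l
    by (simp add: push_arr_def slice_def split: prod.splits)
  show ?thesis
    unfolding variance_functor_def Let_def
  proof (intro conjI ballI allI impI)
    show "FObj ?P \<in> Obj (Shape T) \<rightarrow>\<^sub>E Obj (slice C y)"
      using Comp_in_Hom[OF obj f] by (auto simp: push_functor_def push_obj_def slice_def Hom_def)
    show "FArr ?P \<in> extensional (Arr (Shape T))"
      by (simp add: push_functor_def)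
  next
    fix k assume k: "k \<in> Arr (Shape T)"
    show "FArr ?P k \<in> Hom (slice C y) (FObj ?P (var_src T k)) (FObj ?P (var_tgt T k))"
      using push_arr_in_Hom[OF f variance_functorD(2)[OF F k]] diagram_type_fact(9,10)[OF T k] k
      by (simp add: push_functor_def)
  next
    fix i assume i: "i \<in> Obj (Shape T)"
    have "Ident (Shape T) i \<in> Arr (Shape T)" using I.Ident_in_Hom[OF i] by (simp add: Hom_def)
    moreover have "Src C (f \<cdot> FObj F i) = Src C (FObj F i)"
      using Comp_in_Hom[OF obj[OF i] f] by (simp add: Hom_def)
    ultimately show "FArr ?P (Ident (Shape T) i) = Ident (slice C y) (FObj ?P i)"
      using i variance_functorD(3)[OF F i]
      by (simp add: push_functor_def push_arr_def push_obj_def slice_def)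
  next
    fix k l assume kl: "composable (Shape T) l k"
    let ?u = "sup_cov T l \<cdot>\<^bsub>Shape T\<^esub> sup_contr T k" and ?v = "sub_contr T l \<cdot>\<^bsub>Shape T\<^esub> sub_cov T k"
    have k: "k \<in> Arr (Shape T)" and l: "l \<in> Arr (Shape T)" and e: "Tgt (Shape T) k = Src (Shape T) l"
      using kl by (auto simp: composable_def)
    \<comment> \<open>The factors of \<open>?u\<close> and \<open>?v\<close> must be genuine arrows
      of the shape, since outside them \<open>push_functor\<close> takes a default value.\<close>
    have "composable (Shape T) (sup_cov T l) (sup_contr T k)"
      "composable (Shape T) (sub_contr T l) (sub_cov T k)"
      using diagram_type_fact[OF T k] diagram_type_fact[OF T l] e by (auto simp: composable_def)
    then have u: "?u \<in> Arr (Shape T)" and v: "?v \<in> Arr (Shape T)"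
      using I.composable_compD(1) by auto
    note P' = P[OF I.composable_compD(1)[OF kl]] P[OF k] P[OF l] P[OF diagram_type_fact(1)[OF T u]]
      P[OF diagram_type_fact(2)[OF T u]] P[OF diagram_type_fact(3)[OF T v]]
      P[OF diagram_type_fact(4)[OF T v]] push_comp[symmetric]
    show "FArr ?P (l \<cdot>\<^bsub>Shape T\<^esub> k) =
        (FArr ?P (sup_cov T ?u) \<cdot>\<^bsub>slice C y\<^esub> FArr ?P k) \<cdot>\<^bsub>slice C y\<^esub> FArr ?P (sub_contr T ?v)"
      unfolding P' by (rule arg_cong[OF variance_functorD(4)[OF F kl]])
    show "FArr ?P (l \<cdot>\<^bsub>Shape T\<^esub> k) =
        (FArr ?P (sup_contr T ?u) \<cdot>\<^bsub>slice C y\<^esub> FArr ?P l) \<cdot>\<^bsub>slice C y\<^esub> FArr ?P (sub_cov T ?v)"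
      unfolding P' by (rule arg_cong[OF variance_functorD(5)[OF F kl]])
  qed
qed

section \<open>Subobjects of compact objects, and the two diagram types on the natural
  numbers\<close>

text \<open>Closure of \<open>M\<close> under composition puts each \<open>m F(i)\<close> in
  \<open>M\<close>, so the pushed functor covers \<open>b\<close>. A small object from which it is
  stationary also serves for \<open>F\<close>, as \<open>iso_push_arrD\<close> reflects
  invertibility.\<close>

lemma (in category) compact_obj_tau_subobject:
  assumes M: "system C M" and J: "\<forall>T \<in> J. is_diagram_type T"
    and m: "m \<in> Hom C a b" "m \<in> M" and b: "compact_obj C (tau C J M) b"
  shows "compact_obj C (tau C J M) a"
proof -
  have "\<exists>i\<in>Small T. \<forall>l k. composable (Shape T) k l \<and> Src (Shape T) l = i \<longrightarrow> iso (slice C a) (FArr F k)"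
    if "(T, F) \<in> tau C J M a" for T F
  proof -
    have T: "T \<in> J" "is_diagram_type T" and F: "variance_functor T (slice C a) F"
      and sub: "functor_subordinated M T F"
      using that J by (auto simp: tau_def)
    have "m \<cdot> FObj F i \<in> M" if "i \<in> Obj (Shape T)" for i
    proof -
      have "FObj F i \<in> M" using sub that by (simp add: functor_subordinated_def)
      moreover have "composable C m (FObj F i)"
        using variance_functorD(1)[OF F that] m by (simp add: slice_def composable_def Hom_def)
      ultimately show ?thesis using M m by (simp add: system_def)
    qed
    then have "functor_subordinated M T (push_functor C T m F)"
      by (simp add: functor_subordinated_def push_functor_def push_obj_def)
    with T variance_functor_push[OF T(2) F m(1)]
    have "(T, push_functor C T m F) \<in> tau C J M b" by (simp add: tau_def)
    then obtain i where i: "i \<in> Small T" and iso: "\<And>l k. composable (Shape T) k l \<Longrightarrow>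
        Src (Shape T) l = i \<Longrightarrow> iso (slice C b) (FArr (push_functor C T m F) k)"
      using b by (auto simp: compact_obj_def)
    have "iso (slice C a) (FArr F k)" if "composable (Shape T) k l" "Src (Shape T) l = i" for l k
    proof -
      have k: "k \<in> Arr (Shape T)" using that by (simp add: composable_def)
      then have "FArr F k \<in> Hom (slice C a) (FObj F (var_src T k)) (FObj F (var_tgt T k))"
        by (rule variance_functorD(2)[OF F])
      from iso_push_arrD[OF m(1) this] iso[OF that] k show ?thesis
        by (simp add: push_functor_def)
    qed
    with i show ?thesis by blast
  qed
  then show ?thesis using Hom_objD[OF m(1)] by (auto simp: compact_obj_def)
qed

lemma category_nat_cat: "category nat_cat"
  by unfold_locales (auto simp: nat_cat_def Hom_def)

text \<open>One of the two classes contains only identities, so an arrow can only be factored as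
  itself and an identity; both factorizations are therefore unique. Maxima give
  directedness.\<close>

lemma is_diagram_type_nat_covariant: "is_diagram_type nat_covariant"
proof -
  have "variance nat_cat (Arr nat_cat) (range (Ident nat_cat))"
    unfolding variance_def
    by (auto simp: nat_cat_def composable_def)
  moreover have "\<exists>z. Hom nat_cat x z \<noteq> {} \<and> Hom nat_cat y z \<noteq> {}" for x y
    by (rule exI[of _ "max x y"]) (auto simp: nat_cat_def Hom_def)
  ultimately show ?thesis
    using category_nat_cat by (auto simp: is_diagram_type_def nat_covariant_def nat_cat_def)
qed

lemma is_diagram_type_nat_contravariant: "is_diagram_type nat_contravariant"
proof -
  have "variance nat_cat (range (Ident nat_cat)) (Arr nat_cat)"
    unfolding variance_def
    by (auto simp: nat_cat_def composable_def)
  moreover have "\<exists>z. Hom nat_cat x z \<noteq> {} \<and> Hom nat_cat y z \<noteq> {}" for x y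
    by (rule exI[of _ "max x y"]) (auto simp: nat_cat_def Hom_def)
  ultimately show ?thesis
    using category_nat_cat by (auto simp: is_diagram_type_def nat_contravariant_def nat_cat_def)
qed

section \<open>Coverings subordinated to \<open>M\<close> and quotients of compact objects\<close>

locale subordinated_coverage = category C
  for C :: "('o, 'm) cat" (structure) +
  fixes pb :: "'m \<Rightarrow> 'm \<Rightarrow> 'm \<times> 'm"
    and M :: "'m set"
    and \<tau> :: "('i, 'k, 'o, 'm) selection"
  assumes pb: "pullback_choice C pb"
    and M_left_cancelable: "left_cancelable C M"
    and coverage: "coverage C pb \<tau>" and subordinated: "subordinated C M \<tau>"
begin

lemma covering_props:
  assumes "(T, F) \<in> \<tau> c" "c \<in> Obj C"
  shows "is_diagram_type T" "variance_functor T (slice C c) F" "functor_subordinated M T F"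
  using assms coverage subordinated
  by (auto simp: coverage_def global_selection_def subordinated_def)

text \<open>The transition arrow \<open>h\<close> is in \<open>M\<close> because
  \<open>q h = p\<close>, where \<open>p\<close> and \<open>q\<close> are values of a subordinated
  functor and \<open>M\<close> is left-cancelable.\<close>

lemma covering_arrE:
  assumes "(T, F) \<in> \<tau> c" "c \<in> Obj C" "k \<in> Arr (Shape T)"
  obtains p h q where "FArr F k = (p, h, q)" "p = FObj F (var_src T k)"
    "q = FObj F (var_tgt T k)" "(p, h, q) \<in> Arr (slice C c)" "h \<in> M"
proof -
  note F = covering_props[OF assms(1,2)]
  obtain p h q where 1: "FArr F k = (p, h, q)" "p = FObj F (var_src T k)"
    "q = FObj F (var_tgt T k)" "(p, h, q) \<in> Hom (slice C c) p q"
    using variance_functor_arrE[OF F(1,2) assms(3)] .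
  have pq: "p \<in> M" "q \<in> M"
    using F(3) 1 diagram_type_fact[OF F(1) assms(3)] by (auto simp: functor_subordinated_def)
  moreover have "composable C q h" "q \<cdot> h = p"
    using 1(4) by (auto simp: slice_def Hom_def composable_def)
  ultimately have "h \<in> M" using M_left_cancelable unfolding left_cancelable_def by blast
  with 1 pq show ?thesis using that by (auto simp: Hom_def)
qed

lemma pull_covering:
  assumes "(T, F) \<in> \<tau> y" "f \<in> Hom C x y"
  shows "(T, pull_functor C pb T f F) \<in> \<tau> x"
  using assms coverage by (auto simp: coverage_def Hom_def)

text \<open>Compactness of \<open>x\<close> is applied to the pulled back covering, which has the
  same shape and small objects; the result is restated through \<open>pull_arr\<close>.\<close>

lemma compact_pull_stationary:
  assumes F: "(T, F) \<in> \<tau> y" and f: "f \<in> Hom C x y" and x: "compact_obj C \<tau> x"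
  obtains i where "i \<in> Small T" "\<And>l k. composable (Shape T) k l \<Longrightarrow> Src (Shape T) l = i \<Longrightarrow>
    iso (slice C x) (pull_arr C pb f (FArr F k))"
proof -
  obtain i where i: "i \<in> Small T" and iso: "\<forall>l k. composable (Shape T) k l \<and> Src (Shape T) l = i \<longrightarrow>
    iso (slice C x) (FArr (pull_functor C pb T f F) k)"
    using x pull_covering[OF F f] by (auto simp: compact_obj_def)
  moreover have "FArr (pull_functor C pb T f F) k = pull_arr C pb f (FArr F k)"
    if "composable (Shape T) k l" for k l
    using that by (simp add: pull_functor_def composable_def)
  ultimately show ?thesis using that by metis
qed

text \<open>In the last hypothesis, \<open>h\<close> is an arrow of the diagram, \<open>u\<close> its pullback along \<open>f\<close>, and
  \<open>s\<close>, \<open>s'\<close> are the pullbacks of \<open>f\<close> along the target and the source of \<open>h\<close> in the slice.\<close>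

lemma compact_obj_quotient:
  assumes f: "f \<in> Hom C a b" and a: "compact_obj C \<tau> a" and P: "stably C P f"
    and inv: "\<And>h u s s'. h \<in> M \<Longrightarrow> iso C u \<Longrightarrow> composable C s u \<Longrightarrow> composable C h s' \<Longrightarrow>
       s \<cdot> u = h \<cdot> s' \<Longrightarrow> Src C u = Src C s' \<Longrightarrow> P s \<Longrightarrow> P s' \<Longrightarrow> iso C h"
  shows "compact_obj C \<tau> b"
proof -
  have b: "b \<in> Obj C" using Hom_objD[OF f] by simp
  \<comment> \<open>The chosen square is one particular pullback of \<open>f\<close>, so stability
    applies to its second projection.\<close>
  have Ps: "P (snd (pb f r))" if "r \<in> Arr C" "Tgt C r = b" for r
  proof -
    have "is_pullback C f r (fst (pb f r)) (snd (pb f r))"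
      using pb that HomD[OF f] by (simp add: pullback_choice_def)
    with P show ?thesis unfolding stably_def by blast
  qed
  have "\<exists>i\<in>Small T. \<forall>l k. composable (Shape T) k l \<and> Src (Shape T) l = i \<longrightarrow> iso (slice C b) (FArr F k)"
    if F: "(T, F) \<in> \<tau> b" for T F
  proof -
    obtain i where i: "i \<in> Small T" and iso: "\<And>l k. composable (Shape T) k l \<Longrightarrow>
        Src (Shape T) l = i \<Longrightarrow> iso (slice C a) (pull_arr C pb f (FArr F k))"
      using compact_pull_stationary[OF F f a] by blast
    have "iso (slice C b) (FArr F k)" if kl: "composable (Shape T) k l" "Src (Shape T) l = i" for l k
    proof -
      have k: "k \<in> Arr (Shape T)" using kl by (simp add: composable_def)
      obtain p h q where A: "FArr F k = (p, h, q)" "(p, h, q) \<in> Arr (slice C b)" "h \<in> M"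
        using covering_arrE[OF F b k] by blast
      obtain u where U: "pull_arr C pb f (p, h, q) = (pull_obj pb f p, u, pull_obj pb f q)"
        "(pull_obj pb f p, u, pull_obj pb f q) \<in> Arr (slice C a)"
        "is_pullback C h (snd (pb f q)) (snd (pb f p)) u"
        using pull_arr_pullback[OF pb f A(2)] by blast
      have "iso C u" using iso[OF kl] iso_slice_iff[OF U(2)] A U by simp
      moreover have "P (snd (pb f p))" "P (snd (pb f q))"
        using Ps[of p] Ps[of q] A(2) unfolding slice_def by simp_all
      \<comment> \<open>Here \<open>s\<close> and \<open>s'\<close> are the projections at
        \<open>q\<close> and at \<open>p\<close>, and the pullback square supplies
        \<open>s u = h s'\<close>.\<close>
      ultimately have "iso C h"
        using inv[OF A(3)] U(3) unfolding is_pullback_def by metis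
      then show ?thesis using iso_slice_iff[OF A(2)] A by simp
    qed
    with i show ?thesis by blast
  qed
  with b show ?thesis by (auto simp: compact_obj_def)
qed

text \<open>Inverting \<open>u\<close> in \<open>s u = h s'\<close> exhibits \<open>s\<close> as an
  arrow factoring through \<open>h\<close>, an element of \<open>M\<close>, so extremality of
  \<open>s\<close> makes \<open>h\<close> invertible.\<close>

lemma compact_obj_extremal_quotient:
  assumes "f \<in> Hom C a b" "compact_obj C \<tau> a" "stably C (extremal C M) f"
  shows "compact_obj C \<tau> b"
proof (rule compact_obj_quotient[OF assms])
  fix h u s s'
  assume h: "h \<in> M" and u: "iso C u" and c: "composable C s u" "composable C h s'"
    and e: "s \<cdot> u = h \<cdot> s'" "Src C u = Src C s'" and s: "extremal C M s"
  have U: "u \<in> Hom C (Src C u) (Src C s)" and S: "s \<in> Hom C (Src C s) (Tgt C s)"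
    and S': "s' \<in> Hom C (Src C u) (Src C h)" and H: "h \<in> Hom C (Src C h) (Tgt C h)"
    using c e by (auto simp: composable_def Hom_def)
  obtain v where v: "v \<in> Hom C (Src C s) (Src C u)" "u \<cdot> v = Ident C (Src C s)"
    using isoE[OF u U] by blast
  have "s = (s \<cdot> u) \<cdot> v" using Comp_assoc[OF v(1) U S] v(2) Comp_Ident_right[OF S] by simp
  also have "\<dots> = h \<cdot> (s' \<cdot> v)" using Comp_assoc[OF v(1) S' H] e by simp
  finally have "s = h \<cdot> (s' \<cdot> v)" .
  moreover have "composable C h (s' \<cdot> v)"
    using Comp_in_Hom[OF v(1) S'] H by (auto simp: composable_def Hom_def)
  ultimately show "iso C h" using s h unfolding extremal_def by blast
qed

text \<open>The composite \<open>s u = h s'\<close> is in \<open>E\<close> because \<open>u\<close>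
  is an isomorphism. Cancelling \<open>s'\<close> on the right puts \<open>h\<close> in both
  \<open>E\<close> and \<open>M\<close>.\<close>

lemma compact_obj_right_cancelable_quotient:
  assumes E: "system C E" "right_cancelable C E" "\<forall>g \<in> E \<inter> M. iso C g"
    and f: "f \<in> Hom C a b" "compact_obj C \<tau> a" "stably C (\<lambda>g. g \<in> E) f"
  shows "compact_obj C \<tau> b"
proof (rule compact_obj_quotient[OF f])
  fix h u s s'
  assume h: "h \<in> M" and u: "iso C u" and c: "composable C s u" "composable C h s'"
    and e: "s \<cdot> u = h \<cdot> s'" and s: "s \<in> E" "s' \<in> E"
  have "s \<cdot> u \<in> E" using E(1) u s c unfolding system_def by blast
  then have "h \<in> E" using E(2) c(2) s(2) e unfolding right_cancelable_def by metis
  with E(3) h show "iso C h" by blast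
qed

section \<open>Weak extensions of compact objects\<close>

text \<open>Protomodularity is applied to two rows, at the source and at the target of
  \<open>F(k)\<close>: a projection from the pullback along \<open>\<phi>1\<close>, followed by a
  component of \<open>\<eta>\<close>. The vertical arrows are \<open>u\<close>, \<open>h\<close> and
  \<open>g\<close>; the outer two are invertible by compactness of \<open>a\<close> and
  \<open>c\<close>.\<close>

lemma compact_obj_weak_extension:
  assumes proto: "protomodularity C M E"
    and \<phi>1: "\<phi>1 \<in> Hom C a b" and f: "f \<in> Hom C b c" and \<phi>: "\<phi> \<in> Hom C d c"
    and sq: "is_pullback C f \<phi> \<phi>1 f1"
    and a: "compact_obj C \<tau> a" and c: "compact_obj C \<tau> c" and im: "image_compatible C E M \<tau> f"
  shows "compact_obj C \<tau> b"
proof -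
  have b: "b \<in> Obj C" and cO: "c \<in> Obj C" using Hom_objD[OF f] by auto
  have sf: "Src C f = b" "Tgt C f = c" using f by (auto simp: Hom_def)
  have "\<exists>i\<in>Small T. \<forall>l k. composable (Shape T) k l \<and> Src (Shape T) l = i \<longrightarrow> iso (slice C b) (FArr F k)"
    if F: "(T, F) \<in> \<tau> b" for T F
  proof -
    have T: "is_diagram_type T" using covering_props[OF F b] by simp
    interpret I: category "Shape T" using T by (simp add: is_diagram_type_def)
    obtain G \<eta> where G: "(T, G) \<in> \<tau> c"
      and nat: "natural_transformation T (slice C c) (push_functor C T f F) G \<eta>"
      and \<eta>E: "\<And>i. i \<in> Obj (Shape T) \<Longrightarrow> slice_mor (\<eta> i) \<in> E"
      using im F unfolding image_compatible_def sf by blast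
    obtain i1 where i1: "i1 \<in> Small T" and iso1: "\<And>l k. composable (Shape T) k l \<Longrightarrow>
        Src (Shape T) l = i1 \<Longrightarrow> iso (slice C c) (FArr G k)"
      using c G by (auto simp: compact_obj_def)
    obtain i2 where i2: "i2 \<in> Small T" and iso2: "\<And>l k. composable (Shape T) k l \<Longrightarrow>
        Src (Shape T) l = i2 \<Longrightarrow> iso (slice C a) (pull_arr C pb \<phi>1 (FArr F k))"
      using compact_pull_stationary[OF F \<phi>1 a] by blast
    \<comment> \<open>Compactness speaks of all composable pairs starting at the small object, so a
      pair starting at \<open>i\<close> can be prefixed by \<open>j1\<close> or \<open>j2\<close>
      and both stationarity statements apply.\<close>
    obtain i j1 j2 where i: "i \<in> Small T" and j: "j1 \<in> Hom (Shape T) i1 i" "j2 \<in> Hom (Shape T) i2 i"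
      using T i1 i2 unfolding is_diagram_type_def by blast
    have "iso (slice C b) (FArr F k)" if kl: "composable (Shape T) k l" "Src (Shape T) l = i" for l k
    proof -
      have k: "k \<in> Arr (Shape T)" and l: "l \<in> Hom (Shape T) i (Src (Shape T) k)"
        using kl by (auto simp: composable_def Hom_def)
      have "composable (Shape T) k (l \<cdot>\<^bsub>Shape T\<^esub> j1)" "Src (Shape T) (l \<cdot>\<^bsub>Shape T\<^esub> j1) = i1"
        "composable (Shape T) k (l \<cdot>\<^bsub>Shape T\<^esub> j2)" "Src (Shape T) (l \<cdot>\<^bsub>Shape T\<^esub> j2) = i2"
        using I.Comp_in_Hom[OF j(1) l] I.Comp_in_Hom[OF j(2) l] k by (auto simp: composable_def Hom_def)
      then have isoG: "iso (slice C c) (FArr G k)"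
        and isoP: "iso (slice C a) (pull_arr C pb \<phi>1 (FArr F k))"
        using iso1 iso2 by blast+
      have st: "var_src T k \<in> Obj (Shape T)" "var_tgt T k \<in> Obj (Shape T)"
        using diagram_type_fact[OF T k] by auto
      obtain p h q where A: "FArr F k = (p, h, q)" "p = FObj F (var_src T k)"
        "q = FObj F (var_tgt T k)" "(p, h, q) \<in> Arr (slice C b)" "h \<in> M"
        using covering_arrE[OF F b k] by blast
      obtain p' g q' where B: "FArr G k = (p', g, q')" "p' = FObj G (var_src T k)"
        "q' = FObj G (var_tgt T k)" "(p', g, q') \<in> Arr (slice C c)"
        using covering_arrE[OF G cO k] by blast
      obtain u where U: "pull_arr C pb \<phi>1 (p, h, q) = (pull_obj pb \<phi>1 p, u, pull_obj pb \<phi>1 q)"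
        "(pull_obj pb \<phi>1 p, u, pull_obj pb \<phi>1 q) \<in> Arr (slice C a)"
        "is_pullback C h (snd (pb \<phi>1 q)) (snd (pb \<phi>1 p)) u"
        using pull_arr_pullback[OF pb \<phi>1 A(4)] by blast
      have "iso C u" using isoP iso_slice_iff[OF U(2)] A U by simp
      have "iso C g" using isoG iso_slice_iff[OF B(4)] B by simp
      have h: "h \<in> Hom C (Src C p) (Src C q)" and p: "p \<in> Hom C (Src C p) b"
        and q: "q \<in> Hom C (Src C q) b"
        using A(4) by (auto simp: slice_def Hom_def)
      have g: "g \<in> Hom C (Src C p') (Src C q')" and q': "q' \<in> Hom C (Src C q') c"
        using B(4) by (auto simp: slice_def Hom_def)
      define e' where "e' = slice_mor (\<eta> (var_src T k))"
      define e where "e = slice_mor (\<eta> (var_tgt T k))"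
      have "\<eta> (var_src T k) \<in> Hom (slice C c) (f \<cdot> p) p'" "\<eta> (var_tgt T k) \<in> Hom (slice C c) (f \<cdot> q) q'"
        using nat st unfolding natural_transformation_def A(2,3) B(2,3)
        by (auto simp: push_functor_def push_obj_def)
      moreover have "Src C (f \<cdot> p) = Src C p" "Src C (f \<cdot> q) = Src C q"
        using Comp_in_Hom[OF p f] Comp_in_Hom[OF q f] by (auto simp: Hom_def)
      ultimately have eta: "\<eta> (var_src T k) = (f \<cdot> p, e', p')" "\<eta> (var_tgt T k) = (f \<cdot> q, e, q')"
        and e': "e' \<in> Hom C (Src C p) (Src C p')" and e: "e \<in> Hom C (Src C q) (Src C q')"
        and q'e: "q' \<cdot> e = f \<cdot> q"
        by (auto simp: slice_def Hom_def slice_mor_def e_def e'_def)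
      \<comment> \<open>Naturality at \<open>k\<close>, read on underlying arrows of
        \<open>C\<close>, is the commuting square relating the two components of
        \<open>\<eta>\<close>.\<close>
      have "FArr G k \<cdot>\<^bsub>slice C c\<^esub> \<eta> (var_src T k)
          = \<eta> (var_tgt T k) \<cdot>\<^bsub>slice C c\<^esub> FArr (push_functor C T f F) k"
        using nat k unfolding natural_transformation_def by blast
      then have ge: "g \<cdot> e' = e \<cdot> h"
        unfolding eta using k by (simp add: push_functor_def A B push_arr_def slice_def)
      have EE: "e \<in> E" "e' \<in> E" using \<eta>E st by (auto simp: e_def e'_def)
      have Q: "is_pullback C \<phi>1 q (fst (pb \<phi>1 q)) (snd (pb \<phi>1 q))"
        using pb \<phi>1 q by (auto simp: pullback_choice_def Hom_def)
      \<comment> \<open>Pasting the given square with \<open>Q\<close> shows that the projection at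
        \<open>q\<close> is a pullback of \<open>\<phi>\<close> along \<open>f q\<close>, which
        equals \<open>q' e\<close> because \<open>e\<close> is an arrow over
        \<open>c\<close>.\<close>
      have paste: "is_pullback C (q' \<cdot> e) \<phi> (snd (pb \<phi>1 q)) (f1 \<cdot> fst (pb \<phi>1 q))"
        using pullback_paste[OF sq Q] q'e by simp
      \<comment> \<open>The arrow required by protomodularity is the pullback of
        \<open>\<phi>\<close> along \<open>q'\<close>; it ends at the codomain of
        \<open>e\<close>.\<close>
      let ?\<theta> = "fst (pb q' \<phi>)" and ?t = "snd (pb q' \<phi>)" and ?m = "snd (pb \<phi>1 q)"
      have \<Theta>: "is_pullback C q' \<phi> ?\<theta> ?t"
        using pb q' \<phi> by (auto simp: pullback_choice_def Hom_def)
      obtain w where w: "?\<theta> \<in> Hom C w (Src C q')" "?t \<in> Hom C w d"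
        using is_pullback_HomD[OF \<Theta>] q' \<phi> by (auto simp: Hom_def)
      obtain v where v: "?m \<in> Hom C v (Src C q)" "fst (pb \<phi>1 q) \<in> Hom C v a"
        using is_pullback_HomD[OF Q] q \<phi>1 by (auto simp: Hom_def)
      have f1: "f1 \<in> Hom C a d" using is_pullback_HomD[OF sq] \<phi>1 \<phi> by (auto simp: Hom_def)
      have em: "e \<cdot> ?m \<in> Hom C v (Src C q')" and r: "f1 \<cdot> fst (pb \<phi>1 q) \<in> Hom C v d"
        using Comp_in_Hom v e f1 by blast+
      have "q' \<cdot> (e \<cdot> ?m) = \<phi> \<cdot> (f1 \<cdot> fst (pb \<phi>1 q))"
        using is_pullback_HomD(5)[OF paste] Comp_assoc[OF v(1) e q'] by metis
      from pullback_lift[OF \<Theta> q' \<phi> w(1) em r this]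
      obtain z where z: "z \<in> Hom C v w" "?\<theta> \<cdot> z = e \<cdot> ?m" "?t \<cdot> z = f1 \<cdot> fst (pb \<phi>1 q)" .
      \<comment> \<open>Both squares are transposed so that \<open>\<phi>\<close> is the common
        arrow; cancelling the square over \<open>q'\<close> from the one over \<open>q' e\<close>
        presents \<open>?m\<close> as a pullback of \<open>?\<theta>\<close> along
        \<open>e\<close>.\<close>
      have base: "is_pullback C e ?\<theta> ?m z"
        using pullback_cancel[OF is_pullback_sym[OF \<Theta>] is_pullback_sym[OF paste] q' e v(1) w(1) z(1,3,2)] .
      obtain v' where v': "snd (pb \<phi>1 p) \<in> Hom C v' (Src C p)" "u \<in> Hom C v' v"
        using is_pullback_HomD[OF U(3)] h v by (auto simp: Hom_def)
      have "iso C h"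
        using proto[unfolded protomodularity_def, rule_format, of "snd (pb \<phi>1 p)" v' "Src C p" e' "Src C p'"
            ?m v "Src C q" e "Src C q'" u h g]
          v v' e e' h g U(3) ge base w(1) EE A(5) \<open>iso C u\<close> \<open>iso C g\<close> by metis
      then show ?thesis using iso_slice_iff[OF A(4)] A by simp
    qed
    with i show ?thesis by blast
  qed
  with b show ?thesis by (auto simp: compact_obj_def)
qed

end

theorem theorem2p9:
  fixes C :: "('o, 'm) cat"
    and pb :: "'m \<Rightarrow> 'm \<Rightarrow> 'm \<times> 'm"
    and M E :: "'m set"
    and \<tau> :: "('i, 'k, 'o, 'm) selection"
  assumes "category C" and "pullback_choice C pb"
    and "system C M" and "system C E"
    and "stable C M" and "left_cancelable C M"
    and "coverage C pb \<tau>" and "subordinated C M \<tau>"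
  shows
    "(\<forall>(J :: ('p, 'q) diagram_type set) a b m.
        (\<forall>T \<in> J. is_diagram_type T) \<and> m \<in> Hom C a b \<and> m \<in> M \<and>
        compact_obj C (tau C J M) b
        \<longrightarrow> compact_obj C (tau C J M) a) \<and>
     closed_under_subobjects C M {c. noetherian C M c} \<and>
     closed_under_subobjects C M {c. artinian C M c} \<and>
     (\<forall>a b f. f \<in> Hom C a b \<and> compact_obj C \<tau> a \<longrightarrow>
        (stably C (extremal C M) f \<longrightarrow> compact_obj C \<tau> b) \<and>
        (right_cancelable C E \<and> (\<forall>g \<in> E \<inter> M. iso C g) \<and> stably C (\<lambda>g. g \<in> E) f
           \<longrightarrow> compact_obj C \<tau> b)) \<and>
     (protomodularity C M E \<longrightarrow>
        (\<forall>a b c d f f\<^sub>1 \<phi> \<phi>\<^sub>1.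
           f\<^sub>1 \<in> Hom C a d \<and> \<phi>\<^sub>1 \<in> Hom C a b \<and> f \<in> Hom C b c \<and> \<phi> \<in> Hom C d c \<and>
           is_pullback C f \<phi> \<phi>\<^sub>1 f\<^sub>1 \<and>
           compact_obj C \<tau> a \<and> compact_obj C \<tau> c \<and>
           image_compatible C E M \<tau> f
           \<longrightarrow> compact_obj C \<tau> b))"
proof -
  interpret subordinated_coverage C pb M \<tau>
    using assms by (simp add: subordinated_coverage_def subordinated_coverage_axioms_def)
  \<comment> \<open>The Noetherian and Artinian cases differ only in the diagram type, so both
    follow from the singleton class \<open>{T}\<close>.\<close>
  have closed: "closed_under_subobjects C M {c. compact_obj C (tau C {T} M) c}"
    if T: "is_diagram_type T" for T :: "(nat, nat \<times> nat) diagram_type"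
    unfolding closed_under_subobjects_def
  proof (intro ballI impI CollectI)
    fix m assume m: "m \<in> M" "Tgt C m \<in> {c. compact_obj C (tau C {T} M) c}"
    show "compact_obj C (tau C {T} M) (Src C m)"
    proof (rule compact_obj_tau_subobject[OF assms(3)])
      show "\<forall>T\<in>{T}. is_diagram_type T" using T by simp
      show "m \<in> Hom C (Src C m) (Tgt C m)" using m(1) assms(3) by (auto simp: system_def Hom_def)
    qed (use m in simp_all)
  qed
  show ?thesis
  proof (intro conjI allI impI; (elim conjE)?)
    show "closed_under_subobjects C M {c. noetherian C M c}"
      using closed[OF is_diagram_type_nat_covariant] by (simp only: noetherian_def)
    show "closed_under_subobjects C M {c. artinian C M c}"
      using closed[OF is_diagram_type_nat_contravariant] by (simp only: artinian_def)
  \<comment> \<open>The four remaining goals come in the order of the statement: subobjects, the two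
    quotient criteria, weak extensions.\<close>
  qed ((rule compact_obj_tau_subobject[OF assms(3)], assumption+)[1],
      (rule compact_obj_extremal_quotient, assumption+)[1],
      (rule compact_obj_right_cancelable_quotient[OF assms(4)], assumption+)[1],
      (rule compact_obj_weak_extension, assumption+)[1])
qed

end
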